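(* Consider the interconnected system $\mathcal{S}$, functions $h^1,\dots,h^K$, safety set $\mathcal{C}$ and index sets $\mathcal{N}_1,\mathcal{N}_2$ described in the context, and suppose that $F(x,u)$ is polynomial in $x$ and $u$ and that $h^k(x)$ is polynomial in $x$ for each $k=1,\dots,K$. Suppose $\gamma_i^k$ and $\beta^k$ are given for each $i\in\mathcal{N}_2$ and $k\in\{1,\dots,K\}$, and let $\alpha_i^k$ and $\eta_i^k$ ($i\in\mathcal{N}_1$, $k=1,\dots,K$) be as in the context. Suppose that for each $i\in\mathcal{N}_1$ and $k\in\{1,\dots,K\}$ the following expressions are sum-of-squares (SOS): $$\frac{\partial h^k}{\partial x_i}\big[f_{i,slf}(x_i)+g_{i,slf}(x_i)\tau_i(x)+f_{i,cpl}(x_i,x_{-i})+g_{i,cpl}(x_i,x_{-i})\tau_i(x)\big]-\alpha_i^k\Big(-\eta_i^k(h^k(x))-\beta^k-\sum_{j\in\mathcal{N}_2}\gamma_j^k\Big)-\sum_{s=1}^K\lambda_s(x)h^s(x),$$ $$\tau_{i,j}(x)-\underline{u}_{i,j},\qquad \overline{u}_{i,j}-\tau_{i,j}(x),\qquad j=1,\dots,r_i,$$ where $\lambda_s(x)$ is an SOS polynomial for $s=1,\dots,K$, $\tau_{i,j}(x)$ is a polynomial in $x$ for $i\in\mathcal{N}_1$, $j=1,\dots,r_i$, and $\tau_i(x)=[\tau_{i,1}(x)\cdots\tau_{i,r_i}(x)]^\top$. Then, when $u_i$ is chosen as $u_i=\tau_i(x)$ for all $i\in\mathcal{N}_1$,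 the condition $$\frac{\partial h^k}{\partial x_i}F_i(x_i,x_{-i},u_i)\ \ge\ \alpha_i^k\Big(-\eta_i^k(h^k(x))-\beta^k-\sum_{j\in\mathcal{N}_2}\gamma_j^k\Big)$$ is satisfied for all $x\in\mathcal{C}$, $i\in\mathcal{N}_1$ and $k=1,\dots,K$.
   Context: System. $\mathcal{S}$ consists of sub-systems $\mathcal{S}_1,\dots,\mathcal{S}_N$; $x_i\in\mathbb{R}^{n_i}$ is the state of $\mathcal{S}_i$, $x_{-i}$ is the state of all the other sub-systems, $n=\sum_i n_i$, $x=[x_1^\top\cdots x_N^\top]^\top\in\mathbb{R}^n$. The input $u_i=(u_{i,1},\dots,u_{i,r_i})\in\mathbb{R}^{r_i}$ satisfies $u_i\in\mathcal{U}_i=\prod_{j=1}^{r_i}[\underline{u}_{i,j},\overline{u}_{i,j}]$ with $\underline{u}_{i,j}<\overline{u}_{i,j}$, and $u=[u_1^\top\cdots u_N^\top]^\top$. The dynamics are $\dot x=F(x,u)$, whose $i$-th block is $$\dot x_i=F_i(x_i,x_{-i},u_i)=F_{i,slf}(x_i,u_i)+F_{i,cpl}(x,u_i),$$ with self-dynamics $F_{i,slf}(x_i,u_i)=f_{i,slf}(x_i)+g_{i,slf}(x_i)u_i$ and coupled-dynamics $F_{i,cpl}(x,u_i)=f_{i,cpl}(x_i,x_{-i})+g_{i,cpl}(x_i,x_{-i})u_i$, where $f_{i,slf},g_{i,slf},f_{i,cpl},g_{i,cpl}$ are Lipschitz. Index sets: $\mathcal{N}_1\cup\mathcal{N}_2=\{1,\dots,N\}$,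 $\mathcal{N}_1\cap\mathcal{N}_2=\emptyset$ (protected and vulnerable sub-systems respectively). The functions $h^k:\mathbb{R}^n\to\mathbb{R}$ are continuously differentiable and $\mathcal{C}=\bigcap_{k=1}^K\{x\in\mathbb{R}^n:h^k(x)\ge0\}$ is assumed compact. $\frac{\partial h^k}{\partial x_i}$ denotes the row vector of partial derivatives of $h^k$ with respect to $x_i$, evaluated at $x$. Constants: $\gamma_i^k\in\mathbb{R}$ satisfies $\frac{\partial h^k}{\partial x_i}F_{i,slf}(x_i,u_i)\ge\gamma_i^k$ for all $x\in\mathcal{C}$, $u_i\in\mathcal{U}_i$ ($i\in\mathcal{N}_2$); $\beta^k\in\mathbb{R}$ satisfies $\sum_{i\in\mathcal{N}_2}\frac{\partial h^k}{\partial x_i}F_{i,cpl}(x,u_i)\ge\beta^k$ for all $x\in\mathcal{C}$, $u_i\in\mathcal{U}_i$; $\alpha_i^k\in[0,1]$ with $\sum_{i\in\mathcal{N}_1}\alpha_i^k=1$ for each $k$; $\eta_i^k$ is an extended class $\mathcal{K}$ function (continuous, strictly increasing, $\eta_i^k(0)=0$). A polynomial is SOS if it is a finite sum of squares of real polynomials. *)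

theory Defs
  imports "HOL-Analysis.Analysis"
begin

(* The stacked state x has coordinates indexed by the finite type 'n, and a map
   p :: 'n \<Rightarrow> nat says which sub-system owns each coordinate (for the stacked input:
   'm and a map 'm \<Rightarrow> nat).  Thus n_i is the number of coordinates that p sends to i,
   and R^(n_i) is represented by the coordinate subspace block_space p i. *)

definition block_space :: "('c::finite \<Rightarrow> nat) \<Rightarrow> nat \<Rightarrow> (real^'c) set" where
  "block_space p i = {v. \<forall>c. p c \<noteq> i \<longrightarrow> v $ c = 0}"

definition others_space :: "('c::finite \<Rightarrow> nat) \<Rightarrow> nat \<Rightarrow> (real^'c) set" where
  "others_space p i = {v. \<forall>c. p c = i \<longrightarrow> v $ c = 0}"

(* x_i *)
definition block :: "('c::finite \<Rightarrow> nat) \<Rightarrow> nat \<Rightarrow> real^'c \<Rightarrow> real^'c" where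
  "block p i v = (\<chi> c. if p c = i then v $ c else 0)"

(* x_{-i} *)
definition others :: "('c::finite \<Rightarrow> nat) \<Rightarrow> nat \<Rightarrow> real^'c \<Rightarrow> real^'c" where
  "others p i v = (\<chi> c. if p c = i then 0 else v $ c)"

(* The row vector dh/dx_i at x; its product with v is the inner product. *)
definition block_grad ::
    "('c::finite \<Rightarrow> nat) \<Rightarrow> (real^'c \<Rightarrow> real) \<Rightarrow> nat \<Rightarrow> real^'c \<Rightarrow> real^'c" where
  "block_grad p h i x =
     (\<chi> c. if p c = i then deriv (\<lambda>t. h (x + t *\<^sub>R axis c 1)) 0 else 0)"

record ('n, 'm) system =
  num_sub :: nat
  xown :: "'n \<Rightarrow> nat"
  uown :: "'m \<Rightarrow> nat"
  f_slf :: "nat \<Rightarrow> real^'n \<Rightarrow> real^'n"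
  g_slf :: "nat \<Rightarrow> real^'n \<Rightarrow> real^'m^'n"
  f_cpl :: "nat \<Rightarrow> real^'n \<Rightarrow> real^'n \<Rightarrow> real^'n"
  g_cpl :: "nat \<Rightarrow> real^'n \<Rightarrow> real^'n \<Rightarrow> real^'m^'n"
  u_lo :: "real^'m"
  u_hi :: "real^'m"

definition input_set :: "('n::finite, 'm::finite) system \<Rightarrow> nat \<Rightarrow> (real^'m) set" where
  "input_set S i = {v \<in> block_space (uown S) i.
     \<forall>j. uown S j = i \<longrightarrow> u_lo S $ j \<le> v $ j \<and> v $ j \<le> u_hi S $ j}"

definition F_slf ::
    "('n::finite, 'm::finite) system \<Rightarrow> nat \<Rightarrow> real^'n \<Rightarrow> real^'m \<Rightarrow> real^'n" where
  "F_slf S i xi ui = f_slf S i xi + g_slf S i xi *v ui"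

definition F_cpl ::
    "('n::finite, 'm::finite) system \<Rightarrow> nat \<Rightarrow> real^'n \<Rightarrow> real^'m \<Rightarrow> real^'n" where
  "F_cpl S i x ui =
     f_cpl S i (block (xown S) i x) (others (xown S) i x)
     + g_cpl S i (block (xown S) i x) (others (xown S) i x) *v ui"

(* F_i takes x_i and x_{-i} separately; x_i + x_{-i} is the full state x. *)
definition F_sub ::
    "('n::finite, 'm::finite) system \<Rightarrow> nat \<Rightarrow> real^'n \<Rightarrow> real^'n \<Rightarrow> real^'m \<Rightarrow> real^'n" where
  "F_sub S i xi xo ui = F_slf S i xi ui + F_cpl S i (xi + xo) ui"

(* Stacking the blocks amounts to summing them, as they live in complementary
   coordinate subspaces. *)
definition F_full ::
    "('n::finite, 'm::finite) system \<Rightarrow> real^'n \<Rightarrow> real^'m \<Rightarrow> real^'n" where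
  "F_full S x u = (\<Sum>i\<in>{1..num_sub S}.
     F_sub S i (block (xown S) i x) (others (xown S) i x) (block (uown S) i u))"

(* local_lipschitz is stated for time-dependent maps; the singleton time set makes it
   the usual local Lipschitz property of f on X. *)
abbreviation loc_lipschitz ::
    "'a::metric_space set \<Rightarrow> ('a \<Rightarrow> 'b::metric_space) \<Rightarrow> bool" where
  "loc_lipschitz X f \<equiv> local_lipschitz {0::real} X (\<lambda>_. f)"

definition interconnected_system :: "('n::finite, 'm::finite) system \<Rightarrow> bool" where
  "interconnected_system S \<longleftrightarrow>
     range (xown S) \<subseteq> {1..num_sub S} \<and>
     range (uown S) \<subseteq> {1..num_sub S} \<and>
     (\<forall>j. u_lo S $ j < u_hi S $ j) \<and>
     (\<forall>i\<in>{1..num_sub S}.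
        (\<forall>xi\<in>block_space (xown S) i.
           f_slf S i xi \<in> block_space (xown S) i \<and>
           (\<forall>ui\<in>block_space (uown S) i. g_slf S i xi *v ui \<in> block_space (xown S) i)) \<and>
        (\<forall>xi\<in>block_space (xown S) i. \<forall>xo\<in>others_space (xown S) i.
           f_cpl S i xi xo \<in> block_space (xown S) i \<and>
           (\<forall>ui\<in>block_space (uown S) i. g_cpl S i xi xo *v ui \<in> block_space (xown S) i)) \<and>
        loc_lipschitz (block_space (xown S) i) (f_slf S i) \<and>
        loc_lipschitz (block_space (xown S) i) (g_slf S i) \<and>
        loc_lipschitz (block_space (xown S) i \<times> others_space (xown S) i)
          (\<lambda>(xi, xo). f_cpl S i xi xo) \<and>
        loc_lipschitz (block_space (xown S) i \<times> others_space (xown S) i)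
          (\<lambda>(xi, xo). g_cpl S i xi xo))"

definition C1_function :: "('a::real_normed_vector \<Rightarrow> real) \<Rightarrow> bool" where
  "C1_function h \<longleftrightarrow>
     (\<exists>h'. (\<forall>x. (h has_derivative blinfun_apply (h' x)) (at x)) \<and> continuous_on UNIV h')"

definition safety_set :: "(nat \<Rightarrow> 'a \<Rightarrow> real) \<Rightarrow> nat \<Rightarrow> 'a set" where
  "safety_set h K = (\<Inter>k\<in>{1..K}. {x. h k x \<ge> 0})"

definition extended_class_K :: "(real \<Rightarrow> real) \<Rightarrow> bool" where
  "extended_class_K \<eta> \<longleftrightarrow> continuous_on UNIV \<eta> \<and> strict_mono \<eta> \<and> \<eta> 0 = 0"

definition sos :: "('a::real_normed_vector \<Rightarrow> real) \<Rightarrow> bool" where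
  "sos p \<longleftrightarrow> (\<exists>m (q :: nat \<Rightarrow> 'a \<Rightarrow> real).
     (\<forall>l<m. real_polynomial_function (q l)) \<and> (\<forall>x. p x = (\<Sum>l<m. (q l x)\<^sup>2)))"

(* tau j is the scalar component for input coordinate j; tau_vec S tau i is tau_i. *)
definition tau_vec ::
    "('n::finite, 'm::finite) system \<Rightarrow> ('m \<Rightarrow> real^'n \<Rightarrow> real) \<Rightarrow> nat \<Rightarrow> real^'n \<Rightarrow> real^'m" where
  "tau_vec S \<tau> i x = block (uown S) i (\<chi> j. \<tau> j x)"

end

theory Submission
  imports Defs
begin

text \<open>This is the S-procedure: an SOS certificate for an inequality on all of R^n, with the
  constraints \<open>h s\<close> weighted by SOS multipliers \<open>lam s\<close>, gives the
  inequality on the set where all constraints hold. On \<open>safety_set h K\<close> every product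
  \<open>lam s x * h s x\<close> is nonnegative, because SOS polynomials are nonnegative
  (\<open>sos_nonneg\<close>). The certified expression is nonnegative too, so moving the multiplier
  sum to the other side shows that the gradient term is at least the required bound plus a
  nonnegative quantity. The bracket in the certificate is the dynamics of sub-system
  \<open>i\<close> under the input \<open>tau_vec S \<tau> i x\<close>, once the state is
  reassembled from its two parts (\<open>block_add_others\<close>).\<close>

lemma block_add_others: "block p i x + others p i x = x"
  by (simp add: block_def others_def vec_eq_iff)

lemma sos_nonneg:
  assumes "sos p"
  shows "p x \<ge> 0"
  using assms unfolding sos_def by (metis sum_nonneg zero_le_power2)

theorem lemma3:
  fixes S :: "('n::finite, 'm::finite) system"
    and h :: "nat \<Rightarrow> real^'n \<Rightarrow> real"
    and K :: nat
    and N1 N2 :: "nat set"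
    and \<gamma> :: "nat \<Rightarrow> nat \<Rightarrow> real"
    and \<beta> :: "nat \<Rightarrow> real"
    and \<alpha> :: "nat \<Rightarrow> nat \<Rightarrow> real"
    and \<eta> :: "nat \<Rightarrow> nat \<Rightarrow> real \<Rightarrow> real"
    and lam :: "nat \<Rightarrow> real^'n \<Rightarrow> real"
    and \<tau> :: "'m \<Rightarrow> real^'n \<Rightarrow> real"
  assumes system: "interconnected_system S"
    and index_sets: "N1 \<union> N2 = {1..num_sub S}" "N1 \<inter> N2 = {}"
    and h_C1: "\<And>k. k \<in> {1..K} \<Longrightarrow> C1_function (h k)"
    and C_compact: "compact (safety_set h K)"
    and F_poly: "polynomial_function (\<lambda>(x, u). F_full S x u)"
    and h_poly: "\<And>k. k \<in> {1..K} \<Longrightarrow> real_polynomial_function (h k)"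
    and gamma: "\<And>i k x ui. i \<in> N2 \<Longrightarrow> k \<in> {1..K} \<Longrightarrow> x \<in> safety_set h K \<Longrightarrow> ui \<in> input_set S i \<Longrightarrow>
        block_grad (xown S) (h k) i x \<bullet> F_slf S i (block (xown S) i x) ui \<ge> \<gamma> i k"
    and beta: "\<And>k x u. k \<in> {1..K} \<Longrightarrow> x \<in> safety_set h K \<Longrightarrow>
        (\<forall>i\<in>N2. block (uown S) i u \<in> input_set S i) \<Longrightarrow>
        (\<Sum>i\<in>N2. block_grad (xown S) (h k) i x \<bullet> F_cpl S i x (block (uown S) i u)) \<ge> \<beta> k"
    and alpha_range: "\<And>i k. i \<in> N1 \<Longrightarrow> k \<in> {1..K} \<Longrightarrow> \<alpha> i k \<in> {0..1}"
    and alpha_sum: "\<And>k. k \<in> {1..K} \<Longrightarrow> (\<Sum>i\<in>N1. \<alpha> i k) = 1"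
    and eta: "\<And>i k. i \<in> N1 \<Longrightarrow> k \<in> {1..K} \<Longrightarrow> extended_class_K (\<eta> i k)"
    and lambda_sos: "\<And>s. s \<in> {1..K} \<Longrightarrow> sos (lam s)"
    and tau_poly: "\<And>i j. i \<in> N1 \<Longrightarrow> uown S j = i \<Longrightarrow> real_polynomial_function (\<tau> j)"
    and main_sos: "\<And>i k. i \<in> N1 \<Longrightarrow> k \<in> {1..K} \<Longrightarrow>
        sos (\<lambda>x.
          block_grad (xown S) (h k) i x \<bullet>
            (f_slf S i (block (xown S) i x)
             + g_slf S i (block (xown S) i x) *v tau_vec S \<tau> i x
             + f_cpl S i (block (xown S) i x) (others (xown S) i x)
             + g_cpl S i (block (xown S) i x) (others (xown S) i x) *v tau_vec S \<tau> i x)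
          - \<alpha> i k * (- \<eta> i k (h k x) - \<beta> k - (\<Sum>j\<in>N2. \<gamma> j k))
          - (\<Sum>s\<in>{1..K}. lam s x * h s x))"
    and lower_sos: "\<And>i j. i \<in> N1 \<Longrightarrow> uown S j = i \<Longrightarrow> sos (\<lambda>x. \<tau> j x - u_lo S $ j)"
    and upper_sos: "\<And>i j. i \<in> N1 \<Longrightarrow> uown S j = i \<Longrightarrow> sos (\<lambda>x. u_hi S $ j - \<tau> j x)"
  shows "\<forall>x\<in>safety_set h K. \<forall>u.
      (\<forall>i\<in>N1. block (uown S) i u = tau_vec S \<tau> i x) \<longrightarrow>
      (\<forall>i\<in>N1. \<forall>k\<in>{1..K}.
        block_grad (xown S) (h k) i x \<bullet>
          F_sub S i (block (xown S) i x) (others (xown S) i x) (block (uown S) i u)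
        \<ge> \<alpha> i k * (- \<eta> i k (h k x) - \<beta> k - (\<Sum>j\<in>N2. \<gamma> j k)))"
proof (intro ballI allI impI)
  fix x u i k
  assume x: "x \<in> safety_set h K"
    and u: "\<forall>i\<in>N1. block (uown S) i u = tau_vec S \<tau> i x"
    and i: "i \<in> N1" and k: "k \<in> {1..K}"
  \<comment> \<open>The only place where membership of \<open>x\<close> in the safety set enters: it
    gives the sign of each factor \<open>h s x\<close>.\<close>
  have "(\<Sum>s\<in>{1..K}. lam s x * h s x) \<ge> 0"
    using x by (intro sum_nonneg mult_nonneg_nonneg) (auto simp: safety_set_def sos_nonneg lambda_sos)
  \<comment> \<open>\<open>F_sub\<close> hands the sum of its two state arguments to
    \<open>F_cpl\<close>, which splits it again; \<open>block_add_others\<close> turns that sum back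
    into \<open>x\<close>, so that the terms match the certificate literally.\<close>
  moreover have "F_sub S i (block (xown S) i x) (others (xown S) i x) (block (uown S) i u) =
      f_slf S i (block (xown S) i x)
      + g_slf S i (block (xown S) i x) *v tau_vec S \<tau> i x
      + f_cpl S i (block (xown S) i x) (others (xown S) i x)
      + g_cpl S i (block (xown S) i x) (others (xown S) i x) *v tau_vec S \<tau> i x"
    using u i by (simp add: F_sub_def F_slf_def F_cpl_def block_add_others add.assoc)
  ultimately show "block_grad (xown S) (h k) i x \<bullet>
        F_sub S i (block (xown S) i x) (others (xown S) i x) (block (uown S) i u)
      \<ge> \<alpha> i k * (- \<eta> i k (h k x) - \<beta> k - (\<Sum>j\<in>N2. \<gamma> j k))"
    \<comment> \<open>At \<open>x\<close> the certificate says that the gradient term minus the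
      bound is at least the multiplier sum, which is nonnegative.\<close>
    using sos_nonneg[OF main_sos[OF i k], of x] by simp
qed

end
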